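(* For every integer $k\ge 1$, $$G_{2\text{-}1\text{-}3}^{k(k-1)\ldots 1}(x)=x^kC^2(x),$$ where $G_{2\text{-}1\text{-}3}^{k(k-1)\ldots 1}(x)$ is the ordinary generating function $\sum_{n\ge 1}N(n)x^n$, with $N(n)$ the number of permutations of $\{1,\dots,n\}$ that avoid the classical pattern $2\text{-}1\text{-}3$ and begin with the pattern $k(k-1)\ldots 1$.
   Context: A permutation $\pi=\pi_1\cdots\pi_n$ avoids the classical pattern $2\text{-}1\text{-}3$ if there are no indices $a<b<c$ with $\pi_b<\pi_a<\pi_c$. It begins with the pattern $k(k-1)\ldots 1$ if $n\ge k$ and $\pi_1>\pi_2>\cdots>\pi_k$. The empty permutation is not counted. $C(x)=\sum_{n\ge0}C_nx^n=\frac{1-\sqrt{1-4x}}{2x}$ is the generating function of the Catalan numbers $C_n$, and $C^j(x)=(C(x))^j$. *)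

theory Defs
  imports
    Complex_Main
    "HOL-Computational_Algebra.Formal_Power_Series"
    "HOL-Combinatorics.Multiset_Permutations"
begin

text \<open>
  A permutation of \<open>{1..n}\<close> is given in one-line notation, as an element of the library set
  \<^term>\<open>permutations_of_set {1..n}\<close>; list positions are counted from 0.
\<close>

definition avoids_213 :: "nat list \<Rightarrow> bool" where
  "avoids_213 p \<longleftrightarrow>
     \<not> (\<exists>a b c. a < b \<and> b < c \<and> c < length p \<and> p ! b < p ! a \<and> p ! a < p ! c)"

definition begins_with_decreasing :: "nat \<Rightarrow> nat list \<Rightarrow> bool" where
  "begins_with_decreasing k p \<longleftrightarrow> k \<le> length p \<and> sorted_wrt (>) (take k p)"

definition N_213 :: "nat \<Rightarrow> nat \<Rightarrow> nat" where
  "N_213 k n =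
     card {p \<in> permutations_of_set {1..n}. avoids_213 p \<and> begins_with_decreasing k p}"

text \<open>The generating function sums over \<open>n \<ge> 1\<close>: the empty permutation is not counted.\<close>

definition G_213 :: "nat \<Rightarrow> real fps" where
  "G_213 k = Abs_fps (\<lambda>n. if n = 0 then 0 else real (N_213 k n))"

definition catalan :: "nat \<Rightarrow> real" where
  "catalan n = real ((2 * n) choose n) / real (n + 1)"

definition catalan_fps :: "real fps" where
  "catalan_fps = Abs_fps catalan"

lemma catalan_Suc: "catalan (Suc n) = catalan n * (4 * real n + 2) / (real n + 2)"
proof -
  have catalan: "catalan m = fact (2 * m) / (fact m * fact m * (real m + 1))" for m
    unfolding catalan_def by (subst binomial_fact) (auto simp: add_ac)
  define F :: real where "F = fact (2 * n)"
  define f :: real where "f = fact n"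
  have "f \<noteq> 0" by (simp add: f_def)
  have "fact (2 * Suc n) = (2 * real n + 2) * (2 * real n + 1) * F"
    by (simp add: F_def algebra_simps)
  moreover have "fact (Suc n) = (real n + 1) * f"
    by (simp add: f_def algebra_simps)
  moreover have "real n + 1 \<noteq> 0" "real n + 2 \<noteq> 0" by linarith+
  ultimately show ?thesis
    unfolding catalan F_def [symmetric] f_def [symmetric] using \<open>f \<noteq> 0\<close>
    by (simp add: divide_simps) (simp add: algebra_simps)
qed

lemma gbinomial_half_catalan: "(-4) ^ Suc n * ((1/2 :: real) gchoose Suc n) = - 2 * catalan n"
proof (induction n)
  case 0
  show ?case by (simp add: catalan_def)
next
  case (Suc n)
  have "((1/2 :: real) gchoose Suc (Suc n))
        = ((1/2) gchoose Suc n) * (1/2 - real (Suc n)) / real (Suc (Suc n))"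
    using gbinomial_mult_1[of "1/2 :: real" "Suc n"] by (simp add: field_simps)
  then have "(-4) ^ Suc (Suc n) * ((1/2 :: real) gchoose Suc (Suc n))
        = ((-4) ^ Suc n * ((1/2) gchoose Suc n)) * (-4) * (1/2 - real (Suc n)) / real (Suc (Suc n))"
    by simp
  also have "\<dots> = - 2 * catalan (Suc n)"
    unfolding Suc.IH catalan_Suc by (simp add: field_simps)
  finally show ?case .
qed

lemma catalan_fps_closed_form:
  "catalan_fps = (1 - fps_radical root 2 (1 - 4 * fps_X)) / (2 * fps_X)"
proof -
  define S :: "real fps" where "S = 1 - 2 * fps_X * catalan_fps"
  have S: "S = fps_binomial (1/2) oo (fps_const (-4) * fps_X)"
  proof (rule fps_ext)
    fix n
    have two: "(2 :: real fps) = fps_const 2"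
      by (simp add: numeral_fps_const)
    show "fps_nth S n = fps_nth (fps_binomial (1/2) oo (fps_const (-4) * fps_X)) n"
    proof (cases n)
      case 0
      then show ?thesis by (simp add: S_def two mult.assoc)
    next
      case (Suc m)
      then have "fps_nth S n = - 2 * catalan m"
        by (simp add: S_def two mult.assoc catalan_fps_def)
      also have "\<dots> = fps_nth (fps_binomial (1/2) oo (fps_const (-4) * fps_X)) n"
        unfolding fps_compose_linear using gbinomial_half_catalan[of m] Suc
        by (simp add: fps_binomial_def)
      finally show ?thesis .
    qed
  qed
  have "S ^ 2 = (fps_binomial (1/2) ^ 2) oo (fps_const (-4) * fps_X)"
    unfolding S by (simp add: fps_compose_power)
  also have "fps_binomial (1/2 :: real) ^ 2 = 1 + fps_X"
    by (simp add: fps_binomial_power fps_binomial_1)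
  also have "(1 + fps_X) oo (fps_const (-4 :: real) * fps_X) = 1 - 4 * fps_X"
    by (simp add: fps_compose_add_distrib numeral_fps_const flip: fps_const_neg)
  finally have "S ^ Suc 1 = 1 - 4 * fps_X" by (simp add: numeral_2_eq_2)
  moreover have "fps_nth S 0 = 1" by (simp add: S_def mult.assoc)
  ultimately have "S = fps_radical root (Suc 1) (1 - 4 * fps_X)"
    using radical_unique[of root 1 "1 - 4 * fps_X" S] by simp
  then have "1 - fps_radical root 2 (1 - 4 * fps_X) = catalan_fps * (2 * fps_X)"
    by (simp add: S_def numeral_2_eq_2 algebra_simps)
  moreover have "(2 * fps_X :: real fps) \<noteq> 0"
    by simp
  ultimately show ?thesis
    by (metis nonzero_mult_div_cancel_right)
qed

end

theory Submission
  imports Defs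
begin

text \<open>
  In a \<open>2-1-3\<close>-avoiding word with distinct letters, once a letter below the first letter \<open>x\<close> has
  occurred, no letter above \<open>x\<close> may follow. Both halves of the argument rest on this.

  For \<open>k \<ge> 2\<close> the second letter is already below the first one, so the first letter exceeds all
  others. A leading maximum takes part in no occurrence of \<open>2-1-3\<close>, hence deleting it is a
  bijection that lowers both \<open>k\<close> and the length by one: this is the factor \<open>x\<close>
  (\<open>N_213_Suc_Suc\<close>).

  For \<open>k = 1\<close> the prefix condition only excludes the empty permutation. A nonempty avoider is
  \<open>x # ys @ zs\<close> with \<open>ys\<close> consisting of the letters above \<open>x\<close> and \<open>zs\<close> of those below, and
  \<open>ys\<close> and \<open>zs\<close> are arbitrary avoiders. Counting over \<open>x\<close> gives the Catalan recurrence
  (\<open>card_avoiders\<close>), so the generating function is \<open>C(x) - 1\<close>, which equals \<open>x C(x)\<^sup>2\<close>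
  by the quadratic equation for \<open>C\<close> (\<open>catalan_fps_quadratic\<close>).
\<close>

section \<open>Structure of 2-1-3-avoiding words\<close>

lemma avoids_213_Nil [simp]: "avoids_213 []"
  by (simp add: avoids_213_def)

text \<open>
  An occurrence of \<open>2-1-3\<close> either lies in the tail or uses the head as its \<open>2\<close>. The second
  possibility is phrased with \<^const>\<open>sorted_wrt\<close> so that it can be split along appends.
\<close>

lemma avoids_213_Cons:
  "avoids_213 (x # xs) \<longleftrightarrow> avoids_213 xs \<and> sorted_wrt (\<lambda>u v. \<not> (u < x \<and> x < v)) xs"
proof (intro iffI conjI)
  assume L: "avoids_213 (x # xs)"
  show "avoids_213 xs"
    unfolding avoids_213_def
  proof (intro notI, elim exE conjE)
    fix a b c
    assume "a < b" "b < c" "c < length xs" "xs ! b < xs ! a" "xs ! a < xs ! c"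
    then have "\<exists>a b c. a < b \<and> b < c \<and> c < length (x # xs) \<and>
        (x # xs) ! b < (x # xs) ! a \<and> (x # xs) ! a < (x # xs) ! c"
      by (intro exI[of _ "Suc a"] exI[of _ "Suc b"] exI[of _ "Suc c"]) simp
    with L show False unfolding avoids_213_def by blast
  qed
  show "sorted_wrt (\<lambda>u v. \<not> (u < x \<and> x < v)) xs"
    unfolding sorted_wrt_iff_nth_less
  proof (intro allI impI notI, elim conjE)
    fix b c
    assume "b < c" "c < length xs" "xs ! b < x" "x < xs ! c"
    then have "\<exists>a b c. a < b \<and> b < c \<and> c < length (x # xs) \<and>
        (x # xs) ! b < (x # xs) ! a \<and> (x # xs) ! a < (x # xs) ! c"
      by (intro exI[of _ 0] exI[of _ "Suc b"] exI[of _ "Suc c"]) simp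
    with L show False unfolding avoids_213_def by blast
  qed
next
  assume R: "avoids_213 xs \<and> sorted_wrt (\<lambda>u v. \<not> (u < x \<and> x < v)) xs"
  show "avoids_213 (x # xs)"
    unfolding avoids_213_def
  proof (intro notI, elim exE conjE)
    fix a b c
    assume *: "a < b" "b < c" "c < length (x # xs)"
      "(x # xs) ! b < (x # xs) ! a" "(x # xs) ! a < (x # xs) ! c"
    then obtain b' c' where bc: "b = Suc b'" "c = Suc c'"
      by (metis less_zeroE not0_implies_Suc)
    show False
    proof (cases a)
      case 0
      then show False
        using R * bc by (auto simp: sorted_wrt_iff_nth_less)
    next
      case (Suc a')
      then show False
        using R * bc by (auto simp: avoids_213_def)
    qed
  qed
qed

lemma sorted_wrt_if_all_related:
  assumes "\<And>u v. u \<in> set xs \<Longrightarrow> v \<in> set xs \<Longrightarrow> P u v"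
  shows "sorted_wrt P xs"
  using assms by (induction xs) auto

text \<open>
  The head \<open>x\<close> is not the \<open>2\<close> of an occurrence iff the letters above \<open>x\<close> all precede those
  below it, that is, iff separating the two kinds in order leaves the word unchanged.
\<close>

lemma sorted_wrt_no_less_greater_iff_filter:
  fixes x :: nat
  assumes "x \<notin> set xs"
  shows "sorted_wrt (\<lambda>u v. \<not> (u < x \<and> x < v)) xs \<longleftrightarrow>
    xs = filter (\<lambda>v. x < v) xs @ filter (\<lambda>v. v < x) xs"
  (is "?S xs \<longleftrightarrow> xs = ?F xs")
proof
  assume "?S xs"
  then show "xs = ?F xs"
    using assms
  proof (induction xs)
    case (Cons y ys)
    show ?case
    proof (cases "x < y")
      case True
      then show ?thesis using Cons by auto
    next
      case False
      with Cons.prems have y: "y < x" and ys: "\<forall>v\<in>set ys. v < x"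
        by (auto simp: not_less order_le_less)
      from ys have "filter (\<lambda>v. x < v) ys = []" "filter (\<lambda>v. v < x) ys = ys"
        by (auto simp: filter_empty_conv)
      then show ?thesis using y by auto
    qed
  qed simp
next
  have "?S (filter (\<lambda>v. x < v) xs @ filter (\<lambda>v. v < x) xs)"
    by (auto simp: sorted_wrt_append intro!: sorted_wrt_if_all_related)
  then show "xs = ?F xs \<Longrightarrow> ?S xs" by metis
qed

text \<open>
  When every letter of \<open>ys\<close> exceeds every letter of \<open>zs\<close>, an occurrence whose \<open>2\<close> lies in \<open>ys\<close>
  has its larger \<open>3\<close> in \<open>ys\<close> as well, so no occurrence can straddle the two blocks.
\<close>

lemma avoids_213_append:
  assumes "\<And>y z. y \<in> set ys \<Longrightarrow> z \<in> set zs \<Longrightarrow> z < y"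
  shows "avoids_213 (ys @ zs) \<longleftrightarrow> avoids_213 ys \<and> avoids_213 zs"
  using assms
proof (induction ys)
  case (Cons y ys)
  have "sorted_wrt (\<lambda>u v. \<not> (u < y \<and> y < v)) (ys @ zs) \<longleftrightarrow>
      sorted_wrt (\<lambda>u v. \<not> (u < y \<and> y < v)) ys"
  proof -
    have "\<forall>z\<in>set zs. z < y"
      using Cons.prems by simp
    then show ?thesis
      by (fastforce simp: sorted_wrt_append intro: sorted_wrt_if_all_related)
  qed
  then show ?case
    using Cons by (auto simp: avoids_213_Cons)
qed simp

definition avoiders :: "nat set \<Rightarrow> nat list set" where
  "avoiders A = {p \<in> permutations_of_set A. avoids_213 p}"

lemma finite_avoiders [simp]: "finite (avoiders A)"
  by (cases "finite A") (simp_all add: avoiders_def)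

lemma avoiders_decomposition:
  assumes "A \<noteq> {}"
  shows "avoiders A = (\<Union>x\<in>A. (\<lambda>(ys, zs). x # ys @ zs) `
    (avoiders {v \<in> A. x < v} \<times> avoiders {v \<in> A. v < x}))"
proof (intro equalityI subsetI)
  fix p
  assume p: "p \<in> avoiders A"
  then have "set p = A" "distinct p" "avoids_213 p"
    by (auto simp: avoiders_def permutations_of_set_def)
  with assms obtain x xs where xs: "p = x # xs" "x \<notin> set xs" "distinct xs" "A = insert x (set xs)"
    by (cases p) auto
  define ys zs where "ys = filter (\<lambda>v. x < v) xs" and "zs = filter (\<lambda>v. v < x) xs"
  have eq: "xs = ys @ zs" and "avoids_213 xs"
    using \<open>avoids_213 p\<close> sorted_wrt_no_less_greater_iff_filter[OF xs(2)]
    by (auto simp: avoids_213_Cons xs(1) ys_def zs_def)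
  moreover have "z < y" if "y \<in> set ys" "z \<in> set zs" for y z
    using that by (auto simp: ys_def zs_def)
  ultimately have "avoids_213 ys" "avoids_213 zs"
    using avoids_213_append[of ys zs] by auto
  then have "ys \<in> avoiders {v \<in> A. x < v}" "zs \<in> avoiders {v \<in> A. v < x}"
    using xs by (auto simp: avoiders_def permutations_of_set_def ys_def zs_def)
  then show "p \<in> (\<Union>x\<in>A. (\<lambda>(ys, zs). x # ys @ zs) `
      (avoiders {v \<in> A. x < v} \<times> avoiders {v \<in> A. v < x}))"
    using xs eq by (intro UN_I[of x] image_eqI[of _ _ "(ys, zs)"]) auto
next
  fix p
  assume "p \<in> (\<Union>x\<in>A. (\<lambda>(ys, zs). x # ys @ zs) `
      (avoiders {v \<in> A. x < v} \<times> avoiders {v \<in> A. v < x}))"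
  then obtain x ys zs where p: "x \<in> A" "p = x # ys @ zs"
    and ys: "set ys = {v \<in> A. x < v}" "distinct ys" "avoids_213 ys"
    and zs: "set zs = {v \<in> A. v < x}" "distinct zs" "avoids_213 zs"
    by (auto simp: avoiders_def permutations_of_set_def)
  have notin: "x \<notin> set (ys @ zs)"
    using ys(1) zs(1) by auto
  have "filter (\<lambda>v. x < v) ys = ys" "filter (\<lambda>v. v < x) ys = []"
      "filter (\<lambda>v. x < v) zs = []" "filter (\<lambda>v. v < x) zs = zs"
    using ys(1) zs(1) by (auto simp: filter_id_conv filter_empty_conv)
  then have "sorted_wrt (\<lambda>u v. \<not> (u < x \<and> x < v)) (ys @ zs)"
    using sorted_wrt_no_less_greater_iff_filter[OF notin] by simp
  moreover have "avoids_213 (ys @ zs)"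
    using ys zs by (subst avoids_213_append) auto
  ultimately have "avoids_213 p"
    by (simp add: p avoids_213_Cons)
  moreover have "set p = A"
  proof -
    have "A = insert x ({v \<in> A. x < v} \<union> {v \<in> A. v < x})"
      using p(1) by auto
    then show ?thesis by (simp add: p(2) ys(1) zs(1))
  qed
  moreover have "distinct p"
  proof -
    have "set ys \<inter> set zs = {}"
      unfolding ys(1) zs(1) by auto
    then show ?thesis
      using notin ys(2) zs(2) by (simp add: p(2))
  qed
  ultimately show "p \<in> avoiders A"
    by (simp add: avoiders_def permutations_of_set_def)
qed

section \<open>The Catalan recurrence\<close>

text \<open>The ranks of the elements of a finite set run through an initial segment.\<close>

lemma sum_rank:
  fixes A :: "'a :: linorder set" and f :: "nat \<Rightarrow> 'b :: comm_monoid_add"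
  assumes "finite A"
  shows "(\<Sum>x\<in>A. f (card {v \<in> A. v < x})) = (\<Sum>i<card A. f i)"
  using assms
proof (induction A rule: finite_linorder_max_induct)
  case (insert b A)
  have "{v \<in> insert b A. v < x} = {v \<in> A. v < x}" if "x \<in> A" for x
    using insert.hyps(2) that by (auto dest: less_asym)
  moreover have "{v \<in> insert b A. v < b} = A"
    using insert.hyps(2) by auto
  moreover have "b \<notin> A"
    using insert.hyps(2) by auto
  ultimately show ?case
    using insert.hyps(1) insert.IH by (simp add: add.commute)
qed simp

text \<open>
  Clearing the denominator in the closed form leaves \<open>2 x C = 1 - r\<close> with \<open>r\<^sup>2 = 1 - 4 x\<close>;
  squaring eliminates the root.
\<close>

lemma catalan_fps_quadratic: "catalan_fps = 1 + fps_X * catalan_fps ^ 2"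
proof -
  define r :: "real fps" where "r = fps_radical root 2 (1 - 4 * fps_X)"
  have r2: "r ^ 2 = 1 - 4 * fps_X"
    unfolding r_def using power_radical[of "1 - 4 * fps_X :: real fps" root 1]
    by (simp add: numeral_2_eq_2)
  have two: "(2 :: real fps) = fps_const 2"
    by (simp add: numeral_fps_const)
  have "fps_nth (1 - r) 0 = 0"
    by (simp add: r_def)
  then have "1 - r = fps_X * fps_shift 1 (1 - r)"
    by (intro fps_ext) (simp add: fps_X_mult_nth)
  also have "\<dots> = (2 * fps_X) * (fps_const (1/2) * fps_shift 1 (1 - r))"
    by (simp add: two fps_const_mult[symmetric] mult.assoc mult.left_commute[of _ fps_X]
        del: fps_const_mult) (simp add: mult.assoc[symmetric])
  finally have "(2 * fps_X) dvd (1 - r)"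
    by (metis dvd_triv_left)
  then have "2 * fps_X * catalan_fps = 1 - r"
    by (simp add: catalan_fps_closed_form r_def)
  then have "(1 - 2 * fps_X * catalan_fps) ^ 2 = 1 - 4 * fps_X"
    using r2 by simp
  then have "(4 * fps_X) * catalan_fps = (4 * fps_X) * (1 + fps_X * catalan_fps ^ 2)"
    by (simp add: power2_eq_square algebra_simps)
  moreover have "(4 * fps_X :: real fps) \<noteq> 0"
    by simp
  ultimately show ?thesis
    using mult_left_cancel by blast
qed

lemma catalan_0 [simp]: "catalan 0 = 1"
  by (simp add: catalan_def)

lemma catalan_convolution: "catalan (Suc n) = (\<Sum>i\<le>n. catalan i * catalan (n - i))"
proof -
  have "fps_nth catalan_fps (Suc n) = fps_nth (1 + fps_X * catalan_fps ^ 2) (Suc n)"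
    using catalan_fps_quadratic by simp
  also have "\<dots> = fps_nth (catalan_fps * catalan_fps) n"
    by (simp add: fps_X_mult_nth power2_eq_square)
  finally show ?thesis
    by (simp add: catalan_fps_def fps_mult_nth atLeast0AtMost)
qed

text \<open>
  Arbitrary finite sets of letters are needed here because the blocks above and below the first
  letter are not of the form \<open>{1..n}\<close>.
\<close>

lemma card_avoiders:
  assumes "finite A"
  shows "real (card (avoiders A)) = catalan (card A)"
  using assms
proof (induction A rule: finite_psubset_induct)
  case (psubset A)
  show ?case
  proof (cases "A = {}")
    case True
    then show ?thesis by (simp add: avoiders_def Collect_conv_if)
  next
    case False
    then obtain n where n: "card A = Suc n"
      using psubset.hyps by (metis card_eq_0_iff not0_implies_Suc)
    define P where "P x = avoiders {v \<in> A. x < v} \<times> avoiders {v \<in> A. v < x}" for x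
    have *: "real (card ((\<lambda>(ys, zs). x # ys @ zs) ` P x)) =
        catalan (card {v \<in> A. v < x}) * catalan (n - card {v \<in> A. v < x})" if "x \<in> A" for x
    proof -
      \<comment> \<open>The cut between the two blocks is recovered from the length of the first one.\<close>
      have "inj_on (\<lambda>(ys, zs). x # ys @ zs) (P x)"
        by (auto simp: inj_on_def P_def avoiders_def dest!: length_finite_permutations_of_set)
      then have "real (card ((\<lambda>(ys, zs). x # ys @ zs) ` P x)) =
          real (card (avoiders {v \<in> A. x < v})) * real (card (avoiders {v \<in> A. v < x}))"
        by (simp add: card_image P_def card_cartesian_product)
      also have "\<dots> = catalan (card {v \<in> A. x < v}) * catalan (card {v \<in> A. v < x})"
        using that by (subst (1 2) psubset.IH) auto
      also have "card {v \<in> A. x < v} = n - card {v \<in> A. v < x}"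
      proof -
        have "A = insert x ({v \<in> A. x < v} \<union> {v \<in> A. v < x})"
          using that by auto
        then have "card A = card (insert x ({v \<in> A. x < v} \<union> {v \<in> A. v < x}))"
          by simp
        also have "\<dots> = Suc (card {v \<in> A. x < v} + card {v \<in> A. v < x})"
          using psubset.hyps by (subst card_insert_disjoint) (auto intro!: card_Un_disjoint)
        finally show ?thesis using n by simp
      qed
      finally show ?thesis by simp
    qed
    have "card (avoiders A) = (\<Sum>x\<in>A. card ((\<lambda>(ys, zs). x # ys @ zs) ` P x))"
      unfolding avoiders_decomposition[OF False] P_def[symmetric]
      using psubset.hyps by (intro card_UN_disjoint) (auto simp: P_def)
    then have "real (card (avoiders A)) =
        (\<Sum>x\<in>A. catalan (card {v \<in> A. v < x}) * catalan (n - card {v \<in> A. v < x}))"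
      by (simp add: *)
    also have "\<dots> = (\<Sum>i<card A. catalan i * catalan (n - i))"
      by (rule sum_rank[OF psubset.hyps])
    also have "\<dots> = catalan (card A)"
      by (simp add: n catalan_convolution lessThan_Suc_atMost)
    finally show ?thesis .
  qed
qed

section \<open>Decreasing prefixes\<close>

lemma N_213_1:
  assumes "n > 0"
  shows "real (N_213 1 n) = catalan n"
proof -
  have "begins_with_decreasing 1 p" if "p \<in> permutations_of_set {1..n}" for p
    using that assms length_finite_permutations_of_set[OF that]
    by (cases p) (auto simp: begins_with_decreasing_def)
  then have "{p \<in> permutations_of_set {1..n}. avoids_213 p \<and> begins_with_decreasing 1 p} =
      avoiders {1..n}"
    by (auto simp: avoiders_def)
  then show ?thesis
    by (simp add: N_213_def card_avoiders)
qed

lemma N_213_Suc_0: "N_213 (Suc j) 0 = 0"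
  by (auto simp: N_213_def begins_with_decreasing_def)

text \<open>
  The prefix has length at least two, so the second letter is smaller than the first; avoidance
  then keeps every later letter below the first, which is therefore the maximum \<open>n + 1\<close>.
  Conversely, a prepended maximum extends the decreasing prefix and cannot be the \<open>2\<close> of an
  occurrence.
\<close>

lemma N_213_Suc_Suc: "N_213 (Suc (Suc j)) (Suc n) = N_213 (Suc j) n"
proof -
  have set_eq: "{1..Suc n} = insert (Suc n) {1..n}"
    by auto
  have "{p \<in> permutations_of_set {1..Suc n}.
        avoids_213 p \<and> begins_with_decreasing (Suc (Suc j)) p} =
      (#) (Suc n) ` {p \<in> permutations_of_set {1..n}.
        avoids_213 p \<and> begins_with_decreasing (Suc j) p}" (is "?L = ?R")
  proof (intro equalityI subsetI)
    fix p
    assume "p \<in> ?L"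
    then have p: "set p = {1..Suc n}" "distinct p" "avoids_213 p"
        "begins_with_decreasing (Suc (Suc j)) p"
      by (auto simp: permutations_of_set_def)
    from p(4) obtain x y ys where xy: "p = x # y # ys"
      by (auto simp: begins_with_decreasing_def Suc_le_length_iff)
    have "y < x"
      using p(4) by (auto simp: begins_with_decreasing_def xy)
    then have le: "\<forall>v\<in>set p. v \<le> x"
      using p(3) by (auto simp: xy avoids_213_Cons)
    have "x = Suc n"
    proof (rule antisym)
      show "x \<le> Suc n" using p(1) xy by auto
      show "Suc n \<le> x" using le p(1) by auto
    qed
    have "set (y # ys) = set p - {Suc n}"
      using p(2) xy \<open>x = Suc n\<close> by auto
    then have "y # ys \<in> permutations_of_set {1..n}"
      using p(2) unfolding p(1) set_eq by (auto simp: xy permutations_of_set_def)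
    moreover have "avoids_213 (y # ys)"
      using p(3) by (simp add: xy avoids_213_Cons)
    moreover have "begins_with_decreasing (Suc j) (y # ys)"
      using p(4) by (auto simp: xy begins_with_decreasing_def)
    ultimately show "p \<in> ?R"
      using xy \<open>x = Suc n\<close> by auto
  next
    fix p
    assume "p \<in> ?R"
    then obtain q where q: "p = Suc n # q" "set q = {1..n}" "distinct q" "avoids_213 q"
        "begins_with_decreasing (Suc j) q"
      by (auto simp: permutations_of_set_def)
    have less: "\<forall>v\<in>set q. v < Suc n"
      using q(2) by auto
    then have "avoids_213 p"
      using q(4) by (auto simp: q(1) avoids_213_Cons intro!: sorted_wrt_if_all_related)
    moreover have "begins_with_decreasing (Suc (Suc j)) p"
      using q(5) less by (auto simp: q(1) begins_with_decreasing_def dest: in_set_takeD)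
    moreover have "p \<in> permutations_of_set {1..Suc n}"
      using q(2,3) unfolding set_eq by (auto simp: q(1) permutations_of_set_def)
    ultimately show "p \<in> ?L"
      by simp
  qed
  then show ?thesis
    by (simp add: N_213_def card_image)
qed

lemma G_213_1: "G_213 1 = fps_X * catalan_fps ^ 2"
proof -
  have "G_213 1 = catalan_fps - 1"
    by (rule fps_ext) (simp add: G_213_def catalan_fps_def N_213_1 del: One_nat_def)
  also have "\<dots> = fps_X * catalan_fps ^ 2"
    using catalan_fps_quadratic by (simp add: algebra_simps)
  finally show ?thesis .
qed

lemma G_213_Suc_Suc: "G_213 (Suc (Suc j)) = fps_X * G_213 (Suc j)"
proof (rule fps_ext)
  fix n
  show "fps_nth (G_213 (Suc (Suc j))) n = fps_nth (fps_X * G_213 (Suc j)) n"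
    by (cases n) (auto simp: G_213_def N_213_Suc_Suc N_213_Suc_0)
qed

theorem proposition7:
  fixes k :: nat
  assumes "k \<ge> 1"
  shows "G_213 k = fps_X ^ k * catalan_fps ^ 2"
  using assms
proof (induction k rule: dec_induct)
  case base
  show ?case by (simp add: G_213_1 del: One_nat_def)
next
  case (step k)
  then obtain j where "k = Suc j"
    by (cases k) auto
  then show ?case
    using step.IH by (simp add: G_213_Suc_Suc mult.assoc)
qed

end
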